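(* Let $\{F_2,g,\nabla^{(1)},\nabla^{(-1)}\}$ be the manifold $F_2$ with Fisher metric $g$ and exponential connection $\nabla^{(1)}$. Then $F_2$ can be realized in Euclidean $\mathbb{R}^3$ by the graph of a potential function; namely, $F_2$ can be realized by the affine immersion $\{h,\xi\}$: $$h:\mathcal{G}\to\mathbb{R}^3,\quad \begin{pmatrix}\alpha_1\\\beta_1\end{pmatrix}\mapsto\begin{pmatrix}\alpha_1\\\beta_1\\\psi\end{pmatrix},\qquad \xi=\begin{pmatrix}0\\0\\1\end{pmatrix},$$ where $\psi=-\log(\alpha_1\beta_1)$ and $\xi$ is the transversal vector field along $h$. In $F_2$, the submanifold $W$ consisting of the independent case $(\alpha_1=\beta_1)$ is represented by the curve $$(0,\infty)\to\mathbb{R}^3:\ \alpha_1\mapsto(\alpha_1,\alpha_1,-\log(\alpha_1^2)),\qquad \xi=(0,0,1).$$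
   Context: $F_2$ is the two-parameter family of densities on $(0,\infty)^2$ $$f(x,y;\alpha_1,\beta_1)=\begin{cases}\alpha_1\beta_1\,e^{-\beta_1y-(2\alpha_1-\beta_1)x}&0<x<y,\\\alpha_1\beta_1\,e^{-\beta_1x-(2\alpha_1-\beta_1)y}&0<y<x,\end{cases}$$ with coordinates $(\alpha_1,\beta_1)\in\mathcal{G}=(0,\infty)^2$ (the submanifold $\alpha_1=\alpha_2$, $\beta_1=\beta_2$ of the Freund family); $F_2$ is identified with $\mathcal G$. The Fisher metric is $g_{ij}=-E[\partial_i\partial_j\log f]$. For $\alpha\in\mathbb{R}$, $\nabla^{(\alpha)}$ is the torsion-free connection with $g(\nabla^{(\alpha)}_{\partial_i}\partial_j,\partial_k)=E\big[\partial_i\partial_j\log f\,\partial_k\log f+\frac{1-\alpha}{2}\partial_i\log f\,\partial_j\log f\,\partial_k\log f\big]$, where $E$ is expectation with respect to $f$ and $\partial_1=\partial/\partial\alpha_1$, $\partial_2=\partial/\partial\beta_1$. An immersion $h:M\to\mathbb{R}^{3}$ of a surface together with a vector field $\xi$ along $h$ transversal to $h_*(TM)$ is said to realize $(M,g,\nabla)$ as an affine immersion if $D_X(h_*Y)=h_*(\nabla_XY)+g(X,Y)\,\xi$ for all vector fields $X,Y$ on $M$, where $D$ is the standard flat connection of $\mathbb{R}^{3}$; here it is applied with $\nabla=\nabla^{(1)}$. "Independent case" means that the two random variables $X,Y$ with joint density $f$ are independent, and "represented by the curve" means that the image of $W$ under $h$ is that curve. *)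

theory Defs
  imports "HOL-Probability.Probability"
begin

section \<open>Calculus on an open subset of a coordinate space\<close>

text \<open>A manifold covered by one chart is identified with an open set \<open>M\<close> of \<open>real ^ 'n\<close>;
  vector fields on it are identified with their component functions \<open>real ^ 'n \<Rightarrow> real ^ 'n\<close>.
  Values outside \<open>M\<close> are never constrained.\<close>

text \<open>On open sets of a finite-dimensional space, a function is of class \<open>C\<close> to the \<open>k + 1\<close> iff it is
  differentiable and all its directional derivatives are of class \<open>C\<close> to the \<open>k\<close>.\<close>

primrec Ck_on :: "nat \<Rightarrow> 'a::euclidean_space set \<Rightarrow> ('a \<Rightarrow> 'b::euclidean_space) \<Rightarrow> bool" where
  "Ck_on 0 S f \<longleftrightarrow> continuous_on S f"
| "Ck_on (Suc k) S f \<longleftrightarrow> (\<forall>x\<in>S. f differentiable (at x)) \<and>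
     (\<forall>v. Ck_on k S (\<lambda>x. frechet_derivative f (at x) v))"

definition smooth_on :: "'a::euclidean_space set \<Rightarrow> ('a \<Rightarrow> 'b::euclidean_space) \<Rightarrow> bool" where
  "smooth_on S f \<longleftrightarrow> (\<forall>k. Ck_on k S f)"

text \<open>The derivative of \<open>F\<close> along the vector field \<open>X\<close>: this is \<open>X f\<close> for a scalar function, and the
  standard flat derivative for a vector field along a map into a vector space.\<close>

definition deriv_along ::
  "('a::euclidean_space \<Rightarrow> 'a) \<Rightarrow> ('a \<Rightarrow> 'b::euclidean_space) \<Rightarrow> 'a \<Rightarrow> 'b" where
  "deriv_along X F = (\<lambda>p. frechet_derivative F (at p) (X p))"

definition coord_field :: "'n::finite \<Rightarrow> real ^ 'n \<Rightarrow> real ^ 'n" where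
  "coord_field i = (\<lambda>_. axis i 1)"

definition partial :: "'n::finite \<Rightarrow> (real ^ 'n \<Rightarrow> real) \<Rightarrow> real ^ 'n \<Rightarrow> real" where
  "partial i F = deriv_along (coord_field i) F"

type_synonym 'n conn =
  "(real ^ 'n \<Rightarrow> real ^ 'n) \<Rightarrow> (real ^ 'n \<Rightarrow> real ^ 'n) \<Rightarrow> real ^ 'n \<Rightarrow> real ^ 'n"

definition affine_connection_on :: "(real ^ 'n::finite) set \<Rightarrow> 'n conn \<Rightarrow> bool" where
  "affine_connection_on M nab \<longleftrightarrow>
     (\<forall>X Y. smooth_on M X \<longrightarrow> smooth_on M Y \<longrightarrow> smooth_on M (nab X Y)) \<and>
     (\<forall>X X' Y. smooth_on M X \<longrightarrow> smooth_on M X' \<longrightarrow> smooth_on M Y \<longrightarrow>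
        (\<forall>p\<in>M. nab (\<lambda>q. X q + X' q) Y p = nab X Y p + nab X' Y p)) \<and>
     (\<forall>X Y Y'. smooth_on M X \<longrightarrow> smooth_on M Y \<longrightarrow> smooth_on M Y' \<longrightarrow>
        (\<forall>p\<in>M. nab X (\<lambda>q. Y q + Y' q) p = nab X Y p + nab X Y' p)) \<and>
     (\<forall>(f :: real ^ 'n \<Rightarrow> real) X Y. smooth_on M f \<longrightarrow> smooth_on M X \<longrightarrow> smooth_on M Y \<longrightarrow>
        (\<forall>p\<in>M. nab (\<lambda>q. f q *\<^sub>R X q) Y p = f p *\<^sub>R nab X Y p)) \<and>
     (\<forall>(f :: real ^ 'n \<Rightarrow> real) X Y. smooth_on M f \<longrightarrow> smooth_on M X \<longrightarrow> smooth_on M Y \<longrightarrow>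
        (\<forall>p\<in>M. nab X (\<lambda>q. f q *\<^sub>R Y q) p = deriv_along X f p *\<^sub>R Y p + f p *\<^sub>R nab X Y p))"

text \<open>In a chart, the Lie bracket \<open>[X, Y]\<close> is \<open>deriv_along X Y - deriv_along Y X\<close>.\<close>

definition torsion_free_on :: "(real ^ 'n::finite) set \<Rightarrow> 'n conn \<Rightarrow> bool" where
  "torsion_free_on M nab \<longleftrightarrow>
     (\<forall>X Y. smooth_on M X \<longrightarrow> smooth_on M Y \<longrightarrow>
        (\<forall>p\<in>M. nab X Y p - nab Y X p = deriv_along X Y p - deriv_along Y X p))"

section \<open>Fisher metric and \<open>\<alpha>\<close>-connections of a parametric family of densities\<close>

text \<open>\<open>f p z\<close> is the value at the sample point \<open>z\<close> of the Lebesgue density with parameter \<open>p\<close>.\<close>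

type_synonym ('n, 'a) family = "real ^ 'n \<Rightarrow> 'a \<Rightarrow> real"

definition family_measure :: "('n::finite, 'a::euclidean_space) family \<Rightarrow> real ^ 'n \<Rightarrow> 'a measure" where
  "family_measure f p = density lborel (\<lambda>z. ennreal (f p z))"

definition expect ::
  "('n::finite, 'a::euclidean_space) family \<Rightarrow> real ^ 'n \<Rightarrow> ('a \<Rightarrow> real) \<Rightarrow> real" where
  "expect f p \<phi> = integral\<^sup>L (family_measure f p) \<phi>"

definition loglik :: "('n::finite, 'a::euclidean_space) family \<Rightarrow> 'a \<Rightarrow> real ^ 'n \<Rightarrow> real" where
  "loglik f z = (\<lambda>p. ln (f p z))"

definition fisher_coeff ::
  "('n::finite, 'a::euclidean_space) family \<Rightarrow> 'n \<Rightarrow> 'n \<Rightarrow> real ^ 'n \<Rightarrow> real" where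
  "fisher_coeff f i j p = - expect f p (\<lambda>z. partial i (partial j (loglik f z)) p)"

definition fisher_metric ::
  "('n::finite, 'a::euclidean_space) family \<Rightarrow> real ^ 'n \<Rightarrow> real ^ 'n \<Rightarrow> real ^ 'n \<Rightarrow> real" where
  "fisher_metric f p u v = (\<Sum>i\<in>UNIV. \<Sum>j\<in>UNIV. fisher_coeff f i j p * u $ i * v $ j)"

definition alpha_coeff ::
  "('n::finite, 'a::euclidean_space) family \<Rightarrow> real \<Rightarrow> 'n \<Rightarrow> 'n \<Rightarrow> 'n \<Rightarrow> real ^ 'n \<Rightarrow> real" where
  "alpha_coeff f \<alpha> i j k p = expect f p (\<lambda>z.
     partial i (partial j (loglik f z)) p * partial k (loglik f z) p +
     (1 - \<alpha>) / 2 * partial i (loglik f z) p * partial j (loglik f z) p * partial k (loglik f z) p)"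

definition is_alpha_connection ::
  "(real ^ 'n::finite) set \<Rightarrow> ('n, 'a::euclidean_space) family \<Rightarrow> real \<Rightarrow> 'n conn \<Rightarrow> bool" where
  "is_alpha_connection M f \<alpha> nab \<longleftrightarrow>
     affine_connection_on M nab \<and> torsion_free_on M nab \<and>
     (\<forall>p\<in>M. \<forall>i j k. fisher_metric f p (nab (coord_field i) (coord_field j) p) (coord_field k p)
        = alpha_coeff f \<alpha> i j k p)"

text \<open>A potential function of \<open>(g, nab)\<close>: the coordinates are affine for \<open>nab\<close>, and the components
  of \<open>g\<close> in them are the second partial derivatives of \<open>\<psi>\<close>.\<close>

definition is_potential_function ::
  "(real ^ 'n::finite) set \<Rightarrow> (real ^ 'n \<Rightarrow> real ^ 'n \<Rightarrow> real ^ 'n \<Rightarrow> real) \<Rightarrow> 'n conn \<Rightarrow>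
   (real ^ 'n \<Rightarrow> real) \<Rightarrow> bool" where
  "is_potential_function M g nab \<psi> \<longleftrightarrow> smooth_on M \<psi> \<and>
     (\<forall>p\<in>M. \<forall>i j. nab (coord_field i) (coord_field j) p = 0 \<and>
        g p (coord_field i p) (coord_field j p) = partial i (partial j \<psi>) p)"

section \<open>Affine immersions of surfaces\<close>

text \<open>The push-forward \<open>h\<^sub>* Y\<close> is \<open>deriv_along Y h\<close>.  Since the differential of \<open>h\<close> has rank 2, a vector
  outside its range spans a complement of the range in the three-dimensional target.\<close>

definition realizes_as_affine_immersion ::
  "(real ^ 2) set \<Rightarrow> (real ^ 2 \<Rightarrow> real ^ 2 \<Rightarrow> real ^ 2 \<Rightarrow> real) \<Rightarrow> 2 conn \<Rightarrow>
   (real ^ 2 \<Rightarrow> real ^ 3) \<Rightarrow> (real ^ 2 \<Rightarrow> real ^ 3) \<Rightarrow> bool" where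
  "realizes_as_affine_immersion M g nab h \<xi> \<longleftrightarrow>
     smooth_on M h \<and> (\<forall>p\<in>M. inj (frechet_derivative h (at p))) \<and>
     smooth_on M \<xi> \<and> (\<forall>p\<in>M. \<xi> p \<notin> range (frechet_derivative h (at p))) \<and>
     (\<forall>X Y. smooth_on M X \<longrightarrow> smooth_on M Y \<longrightarrow>
        (\<forall>p\<in>M. deriv_along X (deriv_along Y h) p =
           deriv_along (nab X Y) h p + g p (X p) (Y p) *\<^sub>R \<xi> p))"

text \<open>One-dimensional embedded submanifolds of a surface, as local zero sets of submersions.\<close>

definition is_curve_submanifold :: "(real ^ 2) set \<Rightarrow> (real ^ 2) set \<Rightarrow> bool" where
  "is_curve_submanifold M W \<longleftrightarrow> W \<subseteq> M \<and>
     (\<forall>p\<in>W. \<exists>U (\<phi> :: real ^ 2 \<Rightarrow> real). open U \<and> p \<in> U \<and> U \<subseteq> M \<and> smooth_on U \<phi> \<and>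
        (\<forall>q\<in>U. surj (frechet_derivative \<phi> (at q))) \<and> W \<inter> U = {q \<in> U. \<phi> q = 0})"

section \<open>The family \<open>F\<^sub>2\<close>\<close>

text \<open>The parameter \<open>p\<close> has coordinates \<open>p $ 1 = \<alpha>\<^sub>1\<close> and \<open>p $ 2 = \<beta>\<^sub>1\<close>.\<close>

definition F2_domain :: "(real ^ 2) set" where
  "F2_domain = {p. 0 < p $ 1 \<and> 0 < p $ 2}"

text \<open>The value on the null set \<open>x = y\<close> is immaterial.\<close>

definition F2_density :: "(2, real \<times> real) family" where
  "F2_density p = (\<lambda>(x, y).
     if 0 < x \<and> x < y then p $ 1 * p $ 2 * exp (- p $ 2 * y - (2 * p $ 1 - p $ 2) * x)
     else if 0 < y \<and> y < x then p $ 1 * p $ 2 * exp (- p $ 2 * x - (2 * p $ 1 - p $ 2) * y)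
     else 0)"

text \<open>The parameters for which the two coordinate random variables are independent.\<close>

definition F2_independent :: "(real ^ 2) set" where
  "F2_independent = {p \<in> F2_domain.
     prob_space.indep_var (family_measure F2_density p) borel fst borel snd}"

definition F2_potential :: "real ^ 2 \<Rightarrow> real" where
  "F2_potential p = - ln (p $ 1 * p $ 2)"

definition F2_immersion :: "real ^ 2 \<Rightarrow> real ^ 3" where
  "F2_immersion p = vector [p $ 1, p $ 2, F2_potential p]"

definition F2_transversal :: "real ^ 2 \<Rightarrow> real ^ 3" where
  "F2_transversal p = vector [0, 0, 1]"

end

theory Submission
  imports Defs
begin

text \<open>On the support, the log-likelihood is the sum of \<open>ln p\<^sub>i - s\<^sub>i p\<^sub>i\<close> with
  \<open>s\<^sub>1 = 2 min x y\<close> and \<open>s\<^sub>2 = \<bar>x - y\<bar>\<close>: an exponential family in its natural parameters.  Its second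
  derivatives do not depend on the sample and its score has mean zero, so the parameters are affine
  coordinates of the exponential connection, which is therefore the flat one, and the Fisher metric
  is the Hessian of \<open>- ln (p\<^sub>1 p\<^sub>2)\<close>.  Differentiating the graph twice then gives the immersion equation.

  Moreover, \<open>min x y\<close> and \<open>\<bar>x - y\<bar>\<close> are independent and exponentially distributed with rates \<open>2 p\<^sub>1\<close> and \<open>p\<^sub>2\<close>.
  Comparing \<open>E[X Y]\<close> with \<open>E[X] E[Y]\<close> shows that independence of \<open>X\<close> and \<open>Y\<close> forces \<open>p\<^sub>1 = p\<^sub>2\<close>; in that
  case the density is visibly a product.\<close>

section \<open>Functions of class \<open>C\<close> to the \<open>k\<close>\<close>

text \<open>\<open>frechet_derivative\<close> is a choice term, so it is enough that both functions
  have the same set of derivatives at \<open>x\<close>; this also covers the case where that set is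
  empty.\<close>

lemma frechet_derivative_cong_open:
  assumes "open S" "x \<in> S" "\<And>y. y \<in> S \<Longrightarrow> f y = g y"
  shows "frechet_derivative f (at x) = frechet_derivative g (at x)"
proof -
  have "(f has_derivative D) (at x) \<longleftrightarrow> (g has_derivative D) (at x)" for D
    using has_derivative_transform_within_open[OF _ assms(1,2), of f D UNIV g]
      has_derivative_transform_within_open[OF _ assms(1,2), of g D UNIV f] assms(3) by auto
  then show ?thesis
    unfolding frechet_derivative_def by simp
qed

lemma differentiable_cong_open:
  assumes "open S" "x \<in> S" "\<And>y. y \<in> S \<Longrightarrow> f y = g y" "f differentiable (at x)"
  shows "g differentiable (at x)"
  using assms has_derivative_transform_within_open[OF _ assms(1,2), of f _ UNIV g]
  unfolding differentiable_def by blast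

text \<open>This rule lets closure proofs compute a derivative only at points of \<open>S\<close>
  and then exchange the choice term for that formula. Openness of \<open>S\<close> makes the values
  on \<open>S\<close> determine the derivatives.\<close>

lemma Ck_on_cong:
  assumes "open S" "\<And>y. y \<in> S \<Longrightarrow> f y = g y" "Ck_on k S f"
  shows "Ck_on k S g"
  using assms(2,3)
proof (induction k arbitrary: f g)
  case 0
  then show ?case using continuous_on_cong[of S S f g] by simp
next
  case (Suc k)
  have "Ck_on k S (\<lambda>x. frechet_derivative g (at x) v)" for v
    by (rule Suc.IH[of "\<lambda>x. frechet_derivative f (at x) v"])
      (use Suc.prems frechet_derivative_cong_open[OF assms(1) _ Suc.prems(1)] in auto)
  moreover have "g differentiable (at x)" if "x \<in> S" for x
    using differentiable_cong_open[OF assms(1) that, of f g] Suc.prems that by simp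
  ultimately show ?case by simp
qed

lemma Ck_on_SucD: "Ck_on (Suc k) S f \<Longrightarrow> Ck_on k S f"
proof (induction k arbitrary: f)
  case 0
  then show ?case
    by (simp add: continuous_at_imp_continuous_on differentiable_imp_continuous_within)
qed auto

lemma Ck_on_const: "Ck_on k S (\<lambda>_. c)"
  by (induction k arbitrary: c) auto

lemma Ck_on_linear:
  assumes "bounded_linear L"
  shows "Ck_on k S L"
proof (cases k)
  case 0
  then show ?thesis using assms by (simp add: linear_continuous_on)
next
  case (Suc n)
  have "frechet_derivative L (at x) = L" for x
    by (rule frechet_derivative_at[OF bounded_linear_imp_has_derivative[OF assms], symmetric])
  then show ?thesis
    using Suc bounded_linear_imp_differentiable[OF assms] by (auto intro: Ck_on_const)
qed

lemma Ck_on_compose_linear: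
  assumes "bounded_linear L" "open S" "Ck_on k S f"
  shows "Ck_on k S (\<lambda>x. L (f x))"
  using assms(3)
proof (induction k arbitrary: f)
  case 0
  then show ?case using bounded_linear.continuous_on[OF assms(1)] by auto
next
  case (Suc k)
  have d: "((\<lambda>x. L (f x)) has_derivative (\<lambda>v. L (frechet_derivative f (at x) v))) (at x)"
    if "x \<in> S" for x
    using Suc.prems that
    by (auto intro!: bounded_linear.has_derivative[OF assms(1)] simp: frechet_derivative_works)
  have "Ck_on k S (\<lambda>x. frechet_derivative (\<lambda>x. L (f x)) (at x) v)" for v
    by (rule Ck_on_cong[OF assms(2) _ Suc.IH[of "\<lambda>x. frechet_derivative f (at x) v"]])
      (use Suc.prems frechet_derivative_at[OF d, symmetric] in auto)
  with d show ?case by (auto simp: differentiable_def)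
qed

lemma Ck_on_add:
  assumes "open S" "Ck_on k S f" "Ck_on k S g"
  shows "Ck_on k S (\<lambda>x. f x + g x)"
  using assms(2,3)
proof (induction k arbitrary: f g)
  case 0
  then show ?case by (auto intro: continuous_on_add)
next
  case (Suc k)
  have d: "((\<lambda>x. f x + g x) has_derivative
      (\<lambda>v. frechet_derivative f (at x) v + frechet_derivative g (at x) v)) (at x)" if "x \<in> S" for x
    using Suc.prems that by (auto intro!: has_derivative_add simp: frechet_derivative_works)
  have "Ck_on k S (\<lambda>x. frechet_derivative (\<lambda>x. f x + g x) (at x) v)" for v
    by (rule Ck_on_cong[OF assms(1) _ Suc.IH[of "\<lambda>x. frechet_derivative f (at x) v"
          "\<lambda>x. frechet_derivative g (at x) v"]])
      (use Suc.prems frechet_derivative_at[OF d, symmetric] in auto)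
  with d show ?case by (auto simp: differentiable_def)
qed

text \<open>The product rule brings back the undifferentiated factors, so the induction needs them
  one order lower, which \<open>Ck_on_SucD\<close> provides.\<close>

lemma Ck_on_scaleR:
  assumes "open S" "Ck_on k S f" "Ck_on k S g"
  shows "Ck_on k S (\<lambda>x. f x *\<^sub>R g x)"
  using assms(2,3)
proof (induction k arbitrary: f g)
  case 0
  then show ?case by (auto intro: continuous_on_scaleR)
next
  case (Suc k)
  have d: "((\<lambda>x. f x *\<^sub>R g x) has_derivative
      (\<lambda>v. f x *\<^sub>R frechet_derivative g (at x) v + frechet_derivative f (at x) v *\<^sub>R g x)) (at x)"
    if "x \<in> S" for x
    using Suc.prems that by (auto intro!: has_derivative_scaleR simp: frechet_derivative_works)
  have "Ck_on k S (\<lambda>x. frechet_derivative (\<lambda>x. f x *\<^sub>R g x) (at x) v)" for v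
    by (rule Ck_on_cong[OF assms(1) _ Ck_on_add[OF assms(1) Suc.IH Suc.IH,
          of f "\<lambda>x. frechet_derivative g (at x) v" "\<lambda>x. frechet_derivative f (at x) v" g]])
      (use Suc.prems frechet_derivative_at[OF d, symmetric] Ck_on_SucD[OF Suc.prems(1)]
         Ck_on_SucD[OF Suc.prems(2)] in auto)
  with d show ?case by (auto simp: differentiable_def)
qed

lemma Ck_on_mult:
  fixes f g :: "'a::euclidean_space \<Rightarrow> real"
  assumes "open S" "Ck_on k S f" "Ck_on k S g"
  shows "Ck_on k S (\<lambda>x. f x * g x)"
  using Ck_on_scaleR[OF assms] by simp

lemma Ck_on_sum:
  assumes "open S" "finite A" "\<And>i. i \<in> A \<Longrightarrow> Ck_on k S (f i)"
  shows "Ck_on k S (\<lambda>x. \<Sum>i\<in>A. f i x)"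
  using assms(2,3)
  by (induction A rule: finite_induct) (auto intro!: Ck_on_const Ck_on_add[OF assms(1)])

text \<open>The derivative of the reciprocal contains the reciprocal itself, but only one order
  lower, where the induction hypothesis applies.\<close>

lemma Ck_on_inverse:
  fixes f :: "'a::euclidean_space \<Rightarrow> real"
  assumes "open S" "\<And>x. x \<in> S \<Longrightarrow> f x \<noteq> 0" "Ck_on k S f"
  shows "Ck_on k S (\<lambda>x. inverse (f x))"
  using assms(3)
proof (induction k)
  case 0
  then show ?case using assms(2) by (auto intro!: continuous_on_inverse)
next
  case (Suc k)
  have d: "((\<lambda>x. inverse (f x)) has_derivative
      (\<lambda>v. (- 1) * (inverse (f x) * inverse (f x) * frechet_derivative f (at x) v))) (at x)"
    if "x \<in> S" for x
    using Suc.prems that assms(2)[OF that]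
    by (auto intro!: derivative_eq_intros simp: frechet_derivative_works)
  have inv: "Ck_on k S (\<lambda>x. inverse (f x))"
    by (rule Suc.IH[OF Ck_on_SucD[OF Suc.prems]])
  have "Ck_on k S (\<lambda>x. frechet_derivative (\<lambda>x. inverse (f x)) (at x) v)" for v
    by (rule Ck_on_cong[OF assms(1) _ Ck_on_mult[OF assms(1) Ck_on_const[of k S "- 1"]
        Ck_on_mult[OF assms(1) Ck_on_mult[OF assms(1) inv inv],
          of "\<lambda>x. frechet_derivative f (at x) v"]]])
      (use Suc.prems frechet_derivative_at[OF d, symmetric] in auto)
  with d show ?case by (auto simp: differentiable_def)
qed

text \<open>One differentiation turns the logarithm into a reciprocal times the derivative of
  \<open>f\<close>, so a case split on \<open>k\<close> replaces an induction.\<close>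

lemma Ck_on_ln:
  fixes f :: "'a::euclidean_space \<Rightarrow> real"
  assumes "open S" "\<And>x. x \<in> S \<Longrightarrow> 0 < f x" "Ck_on k S f"
  shows "Ck_on k S (\<lambda>x. ln (f x))"
proof (cases k)
  case 0
  then show ?thesis using assms by (auto intro!: continuous_on_ln) force
next
  case (Suc n)
  have d: "((\<lambda>x. ln (f x)) has_derivative
      (\<lambda>v. inverse (f x) * frechet_derivative f (at x) v)) (at x)" if "x \<in> S" for x
    using Suc assms(3) that assms(2)[OF that]
    by (auto intro!: derivative_eq_intros simp: frechet_derivative_works divide_inverse mult.commute)
  have "Ck_on n S (\<lambda>x. frechet_derivative (\<lambda>x. ln (f x)) (at x) v)" for v
    by (rule Ck_on_cong[OF assms(1) _ Ck_on_mult[OF assms(1) Ck_on_inverse[OF assms(1)],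
          of f n "\<lambda>x. frechet_derivative f (at x) v"]])
      (use assms Suc frechet_derivative_at[OF d, symmetric] Ck_on_SucD[of n S f] in \<open>auto simp: less_le\<close>)
  with d Suc show ?thesis by (auto simp: differentiable_def)
qed

section \<open>Smooth functions and differentiation along a field\<close>

lemma smooth_on_differentiable: "smooth_on S f \<Longrightarrow> x \<in> S \<Longrightarrow> f differentiable (at x)"
  unfolding smooth_on_def using Ck_on.simps(2) by blast

lemma smooth_on_deriv_along:
  assumes "open S" "smooth_on S X" "smooth_on S F"
  shows "smooth_on S (deriv_along X F)"
  unfolding smooth_on_def
proof
  fix k
  \<comment> \<open>\<open>Ck_on\<close> only controls derivatives in fixed directions, so the
    varying direction \<open>X p\<close> is expanded in the standard basis.\<close>
  have "Ck_on k S (\<lambda>p. \<Sum>b\<in>Basis. (X p \<bullet> b) *\<^sub>R frechet_derivative F (at p) b)"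
  proof (intro Ck_on_sum[OF assms(1) finite_Basis] Ck_on_scaleR[OF assms(1)])
    show "Ck_on k S (\<lambda>p. X p \<bullet> b)" for b
      using assms by (intro Ck_on_compose_linear[OF bounded_linear_inner_left])
        (auto simp: smooth_on_def)
    show "Ck_on k S (\<lambda>p. frechet_derivative F (at p) b)" for b
      using assms(3) unfolding smooth_on_def by (metis Ck_on.simps(2))
  qed
  then show "Ck_on k S (deriv_along X F)"
  proof (rule Ck_on_cong[OF assms(1), rotated])
    fix p assume "p \<in> S"
    then have "linear (frechet_derivative F (at p))"
      using smooth_on_differentiable[OF assms(3)] linear_frechet_derivative by blast
    from linear_sum[OF this, of "\<lambda>b. (X p \<bullet> b) *\<^sub>R b" Basis] linear_scale[OF this]
    show "(\<Sum>b\<in>Basis. (X p \<bullet> b) *\<^sub>R frechet_derivative F (at p) b) = deriv_along X F p"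
      by (simp add: deriv_along_def euclidean_representation)
  qed
qed

section \<open>The flat connection of a chart\<close>

lemma deriv_alongI: "(F has_derivative D) (at p) \<Longrightarrow> deriv_along X F p = D (X p)"
  unfolding deriv_along_def by (simp add: frechet_derivative_at[symmetric])

lemma partialI: "(F has_derivative D) (at p) \<Longrightarrow> partial i F p = D (axis i 1)"
  unfolding partial_def by (simp add: deriv_alongI coord_field_def)

lemma smooth_on_component: "open S \<Longrightarrow> smooth_on S X \<Longrightarrow> smooth_on S (\<lambda>q. X q $ i)"
  unfolding smooth_on_def using Ck_on_compose_linear[OF bounded_linear_vec_nth] by blast

lemma smooth_on_const: "smooth_on S (\<lambda>_. c)"
  unfolding smooth_on_def using Ck_on_const by blast

lemma smooth_on_coord_field: "smooth_on S (coord_field i)"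
  unfolding coord_field_def by (rule smooth_on_const)

lemma smooth_on_scaleR:
  "open S \<Longrightarrow> smooth_on S f \<Longrightarrow> smooth_on S g \<Longrightarrow> smooth_on S (\<lambda>q. f q *\<^sub>R g q)"
  unfolding smooth_on_def using Ck_on_scaleR by blast

lemma smooth_on_sum:
  "open S \<Longrightarrow> finite A \<Longrightarrow> (\<And>i. i \<in> A \<Longrightarrow> smooth_on S (f i)) \<Longrightarrow> smooth_on S (\<lambda>q. \<Sum>i\<in>A. f i q)"
  unfolding smooth_on_def using Ck_on_sum by blast

text \<open>Linearity of the derivative at a point gives the rules in the first field, the product
  rule gives the Leibniz rule in the second.\<close>

lemma affine_connection_on_deriv_along:
  fixes M :: "(real ^ 'n::finite) set"
  assumes "open M"
  shows "affine_connection_on M deriv_along"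
  unfolding affine_connection_on_def
proof (intro conjI allI impI ballI)
  show "smooth_on M (deriv_along X Y)" if "smooth_on M X" "smooth_on M Y"
    for X Y :: "real ^ 'n \<Rightarrow> real ^ 'n"
    using smooth_on_deriv_along[OF assms that] .
next
  fix X X' Y :: "real ^ 'n \<Rightarrow> real ^ 'n" and p
  assume "smooth_on M Y" "p \<in> M"
  then have "linear (frechet_derivative Y (at p))"
    using smooth_on_differentiable linear_frechet_derivative by blast
  then show "deriv_along (\<lambda>q. X q + X' q) Y p = deriv_along X Y p + deriv_along X' Y p"
    by (simp add: deriv_along_def linear_add)
next
  fix X Y Y' :: "real ^ 'n \<Rightarrow> real ^ 'n" and p
  assume "smooth_on M Y" "smooth_on M Y'" "p \<in> M"
  then have "(Y has_derivative frechet_derivative Y (at p)) (at p)"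
    "(Y' has_derivative frechet_derivative Y' (at p)) (at p)"
    using smooth_on_differentiable frechet_derivative_works by blast+
  from deriv_alongI[OF has_derivative_add[OF this]]
  show "deriv_along X (\<lambda>q. Y q + Y' q) p = deriv_along X Y p + deriv_along X Y' p"
    by (simp add: deriv_along_def)
next
  fix f :: "real ^ 'n \<Rightarrow> real" and X Y :: "real ^ 'n \<Rightarrow> real ^ 'n" and p
  assume "smooth_on M Y" "p \<in> M"
  then have "linear (frechet_derivative Y (at p))"
    using smooth_on_differentiable linear_frechet_derivative by blast
  then show "deriv_along (\<lambda>q. f q *\<^sub>R X q) Y p = f p *\<^sub>R deriv_along X Y p"
    by (simp add: deriv_along_def linear_scale)
next
  fix f :: "real ^ 'n \<Rightarrow> real" and X Y :: "real ^ 'n \<Rightarrow> real ^ 'n" and p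
  assume "smooth_on M f" "smooth_on M Y" "p \<in> M"
  then have "(f has_derivative frechet_derivative f (at p)) (at p)"
    "(Y has_derivative frechet_derivative Y (at p)) (at p)"
    using smooth_on_differentiable frechet_derivative_works by blast+
  from deriv_alongI[OF has_derivative_scaleR[OF this]]
  show "deriv_along X (\<lambda>q. f q *\<^sub>R Y q) p = deriv_along X f p *\<^sub>R Y p + f p *\<^sub>R deriv_along X Y p"
    by (simp add: deriv_along_def)
qed

lemma torsion_free_on_deriv_along: "torsion_free_on M deriv_along"
  by (simp add: torsion_free_on_def)

lemma sum_coord_field: "(\<Sum>i\<in>UNIV. (v $ i) *\<^sub>R coord_field i q) = v"
  using basis_expansion[of v] by (simp add: coord_field_def scalar_mult_eq_scaleR)

section \<open>Expansion of a connection in the coordinate fields\<close>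

context
  fixes M :: "(real ^ 'n::finite) set" and nab :: "'n conn"
  assumes M: "open M" and nab: "affine_connection_on M nab"
begin

lemma connection_rules:
  fixes f :: "real ^ 'n \<Rightarrow> real"
  assumes "smooth_on M X" "smooth_on M Y" "p \<in> M"
  shows connection_add_left:
      "smooth_on M X' \<Longrightarrow> nab (\<lambda>q. X q + X' q) Y p = nab X Y p + nab X' Y p"
    and connection_add_right:
      "smooth_on M Y' \<Longrightarrow> nab X (\<lambda>q. Y q + Y' q) p = nab X Y p + nab X Y' p"
    and connection_scaleR_left:
      "smooth_on M f \<Longrightarrow> nab (\<lambda>q. f q *\<^sub>R X q) Y p = f p *\<^sub>R nab X Y p"
    and connection_scaleR_right:
      "smooth_on M f \<Longrightarrow>
        nab X (\<lambda>q. f q *\<^sub>R Y q) p = deriv_along X f p *\<^sub>R Y p + f p *\<^sub>R nab X Y p"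
  using nab assms unfolding affine_connection_on_def by simp_all

lemma connection_sum_right:
  assumes "finite A" "\<And>i. i \<in> A \<Longrightarrow> smooth_on M (Y i)" "smooth_on M X" "p \<in> M"
  shows "nab X (\<lambda>q. \<Sum>i\<in>A. Y i q) p = (\<Sum>i\<in>A. nab X (Y i) p)"
  using assms(1,2)
proof (induction A rule: finite_induct)
  case empty
  \<comment> \<open>Additivity at \<open>0 + 0 = 0\<close> forces the value on the zero field to
    equal its own double.\<close>
  have "nab X (\<lambda>q. 0 + 0) p = nab X (\<lambda>q. 0) p + nab X (\<lambda>q. 0) p"
    by (rule connection_add_right[OF assms(3) smooth_on_const assms(4) smooth_on_const])
  then show ?case by simp
next
  case (insert i A)
  have "nab X (\<lambda>q. Y i q + (\<Sum>j\<in>A. Y j q)) p = nab X (Y i) p + nab X (\<lambda>q. \<Sum>j\<in>A. Y j q) p"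
    by (rule connection_add_right[OF assms(3) _ assms(4)])
      (auto intro!: insert.prems smooth_on_sum[OF M insert.hyps(1)])
  with insert show ?case by simp
qed

lemma connection_sum_left:
  assumes "finite A" "\<And>i. i \<in> A \<Longrightarrow> smooth_on M (X i)" "smooth_on M Y" "p \<in> M"
  shows "nab (\<lambda>q. \<Sum>i\<in>A. X i q) Y p = (\<Sum>i\<in>A. nab (X i) Y p)"
  using assms(1,2)
proof (induction A rule: finite_induct)
  case empty
  have "nab (\<lambda>q. 0 + 0) Y p = nab (\<lambda>q. 0) Y p + nab (\<lambda>q. 0) Y p"
    by (rule connection_add_left[OF smooth_on_const assms(3,4) smooth_on_const])
  then show ?case by simp
next
  case (insert i A)
  have "nab (\<lambda>q. X i q + (\<Sum>j\<in>A. X j q)) Y p = nab (X i) Y p + nab (\<lambda>q. \<Sum>j\<in>A. X j q) Y p"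
    by (rule connection_add_left[OF _ assms(3,4)])
      (auto intro!: insert.prems smooth_on_sum[OF M insert.hyps(1)])
  with insert show ?case by simp
qed

text \<open>Both fields are expanded in the coordinate frame. Function-linearity in \<open>X\<close>
  and the Leibniz rule in \<open>Y\<close> leave the derivatives of the components of
  \<open>Y\<close> and terms with Christoffel symbols, and \<open>flat\<close> kills the
  latter.\<close>

lemma flat_connection_eq_deriv_along:
  assumes flat: "\<And>i j p. p \<in> M \<Longrightarrow> nab (coord_field i) (coord_field j) p = 0"
    and X: "smooth_on M X" and Y: "smooth_on M Y" and p: "p \<in> M"
  shows "nab X Y p = deriv_along X Y p"
proof -
  note comp = smooth_on_component[OF M] smooth_on_scaleR[OF M] smooth_on_coord_field
  have 1: "nab X (coord_field j) p = 0" for j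
  proof -
    have "nab (\<lambda>q. \<Sum>i\<in>UNIV. (X q $ i) *\<^sub>R coord_field i q) (coord_field j) p =
        (\<Sum>i\<in>UNIV. nab (\<lambda>q. (X q $ i) *\<^sub>R coord_field i q) (coord_field j) p)"
      by (rule connection_sum_left) (auto intro!: comp X p)
    also have "\<dots> = (\<Sum>i\<in>UNIV. (X p $ i) *\<^sub>R nab (coord_field i) (coord_field j) p)"
      by (intro sum.cong refl connection_scaleR_left comp X p)
    finally show ?thesis
      by (simp add: flat[OF p] sum_coord_field)
  qed
  have "nab X (\<lambda>q. \<Sum>j\<in>UNIV. (Y q $ j) *\<^sub>R coord_field j q) p =
      (\<Sum>j\<in>UNIV. nab X (\<lambda>q. (Y q $ j) *\<^sub>R coord_field j q) p)"
    by (rule connection_sum_right) (auto intro!: comp X Y p)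
  also have "\<dots> = (\<Sum>j\<in>UNIV. deriv_along X (\<lambda>q. Y q $ j) p *\<^sub>R coord_field j p +
      (Y p $ j) *\<^sub>R nab X (coord_field j) p)"
    by (intro sum.cong refl connection_scaleR_right comp X Y p)
  also have "\<dots> = (\<Sum>j\<in>UNIV. (deriv_along X Y p $ j) *\<^sub>R coord_field j p)"
  proof -
    have "(Y has_derivative frechet_derivative Y (at p)) (at p)"
      using smooth_on_differentiable[OF Y p] frechet_derivative_works by blast
    from deriv_alongI[OF bounded_linear.has_derivative[OF bounded_linear_vec_nth this]]
    have "deriv_along X (\<lambda>q. Y q $ j) p = deriv_along X Y p $ j" for j
      by (simp add: deriv_along_def)
    then show ?thesis by (simp add: 1)
  qed
  finally show ?thesis
    by (simp add: sum_coord_field)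
qed

end

section \<open>Expectations under the densities\<close>

lemma sets_family_measure [measurable_cong, simp]: "sets (family_measure f p) = sets borel"
  by (simp add: family_measure_def)

lemma space_family_measure [simp]: "space (family_measure f p) = UNIV"
  by (simp add: family_measure_def)

lemma F2_density_measurable [measurable]: "F2_density p \<in> borel_measurable borel"
  unfolding F2_density_def borel_prod[symmetric] by measurable

lemma AE_F2:
  "AE z in family_measure F2_density p. 0 < fst z \<and> 0 < snd z \<and> fst z \<noteq> snd z"
  proof -
  have "AE z in lborel. 0 < ennreal (F2_density p z) \<longrightarrow> 0 < fst z \<and> 0 < snd z \<and> fst z \<noteq> snd z"
    by (intro AE_I2) (auto simp: F2_density_def split: prod.splits if_splits)
  then show ?thesis
    unfolding family_measure_def by (subst AE_density) simp_all
qed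

text \<open>In the coordinates \<open>min x y\<close> and \<open>\<bar>x - y\<bar>\<close> the law becomes a product of two exponential laws.\<close>

lemma nn_integral_F2:
  assumes p: "p \<in> F2_domain" and [measurable]: "\<phi> \<in> borel_measurable borel"
  shows "(\<integral>\<^sup>+z. \<phi> z \<partial>family_measure F2_density p) =
    (\<integral>\<^sup>+x. \<integral>\<^sup>+t. ennreal (exponential_density (2 * p $ 1) x * exponential_density (p $ 2) t / 2) *
      (\<phi> (x, x + t) + \<phi> (x + t, x)) \<partial>lborel \<partial>lborel)"
proof -
  \<comment> \<open>\<open>H\<close> is the branch \<open>x < y\<close> of the density; the other
    branch is \<open>H\<close> with its arguments swapped, so both can be carried to the same
    region.\<close>
  define H where "H x y =
    (if 0 < x \<and> x < y then p $ 1 * p $ 2 * exp (- p $ 2 * y - (2 * p $ 1 - p $ 2) * x) else 0)"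
    for x y :: real
  have H_nonneg: "0 \<le> H x y" for x y
    using p by (auto simp: H_def F2_domain_def)
  have H_meas [measurable]: "(\<lambda>z. H (f z) (g z)) \<in> borel_measurable M"
    if [measurable]: "f \<in> borel_measurable M" "g \<in> borel_measurable M" for M :: "'x measure" and f g
    unfolding H_def by measurable
  have [measurable]: "\<phi> \<in> borel_measurable (lborel \<Otimes>\<^sub>M lborel)"
    by (simp add: lborel_prod)
  have dens: "ennreal (F2_density p (x, y)) = ennreal (H x y) + ennreal (H y x)" for x y
    by (auto simp: F2_density_def H_def)
  have "(\<integral>\<^sup>+z. \<phi> z \<partial>family_measure F2_density p) = (\<integral>\<^sup>+z. F2_density p z * \<phi> z \<partial>lborel)"
    unfolding family_measure_def by (rule nn_integral_density) auto
  also have "\<dots> = (\<integral>\<^sup>+z. ennreal (H (fst z) (snd z)) * \<phi> (fst z, snd z) +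
      ennreal (H (snd z) (fst z)) * \<phi> (fst z, snd z) \<partial>(lborel \<Otimes>\<^sub>M lborel))"
    unfolding lborel_prod by (intro nn_integral_cong) (auto simp: dens distrib_right)
  also have "\<dots> = (\<integral>\<^sup>+z. ennreal (H (fst z) (snd z)) * \<phi> (fst z, snd z) \<partial>(lborel \<Otimes>\<^sub>M lborel)) +
      (\<integral>\<^sup>+z. ennreal (H (snd z) (fst z)) * \<phi> (fst z, snd z) \<partial>(lborel \<Otimes>\<^sub>M lborel))"
    by (rule nn_integral_add) measurable
  \<comment> \<open>Tonelli, with the smaller coordinate as outer variable in each piece: the first
    coordinate in one, the second, renamed to \<open>x\<close>, in the other.\<close>
  also have "\<dots> = (\<integral>\<^sup>+x. \<integral>\<^sup>+y. ennreal (H x y) * \<phi> (x, y) \<partial>lborel \<partial>lborel) +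
      (\<integral>\<^sup>+x. \<integral>\<^sup>+y. ennreal (H x y) * \<phi> (y, x) \<partial>lborel \<partial>lborel)"
    using lborel.nn_integral_fst[of "\<lambda>z. ennreal (H (fst z) (snd z)) * \<phi> (fst z, snd z)" lborel]
      lborel_pair.nn_integral_snd[of "\<lambda>z. ennreal (H (snd z) (fst z)) * \<phi> (fst z, snd z)"]
    by simp
  also have "\<dots> = (\<integral>\<^sup>+x. \<integral>\<^sup>+y. ennreal (H x y) * (\<phi> (x, y) + \<phi> (y, x)) \<partial>lborel \<partial>lborel)"
    by (simp add: nn_integral_add distrib_left)
  also have "\<dots> = (\<integral>\<^sup>+x. \<integral>\<^sup>+t. ennreal (H x (x + t)) * (\<phi> (x, x + t) + \<phi> (x + t, x)) \<partial>lborel \<partial>lborel)"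
  proof (rule nn_integral_cong)
    fix x :: real
    show "(\<integral>\<^sup>+y. ennreal (H x y) * (\<phi> (x, y) + \<phi> (y, x)) \<partial>lborel) =
        (\<integral>\<^sup>+t. ennreal (H x (x + t)) * (\<phi> (x, x + t) + \<phi> (x + t, x)) \<partial>lborel)"
      by (subst nn_integral_real_affine[where c = 1 and t = x]) auto
  qed
  also have "\<dots> = (\<integral>\<^sup>+x. \<integral>\<^sup>+t. ennreal (exponential_density (2 * p $ 1) x *
      exponential_density (p $ 2) t / 2) * (\<phi> (x, x + t) + \<phi> (x + t, x)) \<partial>lborel \<partial>lborel)"
  proof (rule nn_integral_cong_AE)
    \<comment> \<open>The exponent becomes \<open>- 2 * p $ 1 * x - p $ 2 * t\<close>, and
      \<open>p $ 1 * p $ 2\<close> is half the product of the two rates. The value 0 is excluded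
      because \<open>exponential_density\<close> is positive there while \<open>H\<close>
      vanishes.\<close>
    have "H x (x + t) = exponential_density (2 * p $ 1) x * exponential_density (p $ 2) t / 2"
      if "x \<noteq> 0" "t \<noteq> 0" for x t
      using that by (auto simp: H_def exponential_density_def algebra_simps simp flip: exp_add)
    then have "(\<integral>\<^sup>+t. ennreal (H x (x + t)) * (\<phi> (x, x + t) + \<phi> (x + t, x)) \<partial>lborel) =
      (\<integral>\<^sup>+t. ennreal (exponential_density (2 * p $ 1) x *
        exponential_density (p $ 2) t / 2) * (\<phi> (x, x + t) + \<phi> (x + t, x)) \<partial>lborel)"
      if "x \<noteq> 0" for x
      using that
      by (intro nn_integral_cong_AE eventually_mono[OF AE_lborel_singleton[of 0]])
        (simp only: not_False_eq_True)
    then show "AE x in lborel. (\<integral>\<^sup>+t. ennreal (H x (x + t)) * (\<phi> (x, x + t) + \<phi> (x + t, x)) \<partial>lborel) =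
      (\<integral>\<^sup>+t. ennreal (exponential_density (2 * p $ 1) x *
        exponential_density (p $ 2) t / 2) * (\<phi> (x, x + t) + \<phi> (x + t, x)) \<partial>lborel)"
      by (rule eventually_mono[OF AE_lborel_singleton[of 0]])
  qed
  finally show ?thesis .
qed

text \<open>By \<open>nn_integral_F2\<close> only the symmetrised value of \<open>\<phi>\<close>
  matters, and its factor 2 cancels the \<open>1 / 2\<close> there. When it is a monomial, the
  integral splits into an \<open>i\<close>-th and a \<open>j\<close>-th moment of exponential
  laws.\<close>

lemma has_bochner_integral_F2:
  assumes p: "p \<in> F2_domain" and cont: "continuous_on UNIV \<phi>" and c: "0 \<le> c"
    and nonneg: "\<And>x y. 0 < x \<Longrightarrow> 0 < y \<Longrightarrow> 0 \<le> \<phi> (x, y)"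
    and sum: "\<And>x t. 0 < x \<Longrightarrow> 0 < t \<Longrightarrow> \<phi> (x, x + t) + \<phi> (x + t, x) = 2 * c * x ^ i * t ^ j"
  shows "has_bochner_integral (family_measure F2_density p) \<phi>
    (c * (fact i / (2 * p $ 1) ^ i) * (fact j / (p $ 2) ^ j))"
proof (rule has_bochner_integral_nn_integral)
  let ?e = "exponential_density (2 * p $ 1)" and ?d = "exponential_density (p $ 2)"
  have [measurable]: "\<phi> \<in> borel_measurable borel"
    using cont by (rule borel_measurable_continuous_onI)
  have pos: "0 < p $ 1" "0 < p $ 2" using p by (auto simp: F2_domain_def)
  then show "0 \<le> c * (fact i / (2 * p $ 1) ^ i) * (fact j / (p $ 2) ^ j)"
    using c by simp
  show "\<phi> \<in> borel_measurable (family_measure F2_density p)"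
    by simp
  show "AE z in family_measure F2_density p. 0 \<le> \<phi> z"
    using AE_F2 by eventually_elim (use nonneg in force)
  have "(\<integral>\<^sup>+z. \<phi> z \<partial>family_measure F2_density p) =
      (\<integral>\<^sup>+x. \<integral>\<^sup>+t. ennreal (?e x * ?d t / 2) *
        (ennreal (\<phi> (x, x + t)) + ennreal (\<phi> (x + t, x))) \<partial>lborel \<partial>lborel)"
    by (rule nn_integral_F2[OF p]) simp
  also have "\<dots> = (\<integral>\<^sup>+x. \<integral>\<^sup>+t. ennreal c * ennreal (?e x * x ^ i) * ennreal (?d t * t ^ j) \<partial>lborel \<partial>lborel)"
  proof (rule nn_integral_cong_AE)
    \<comment> \<open>Where an argument is negative, its density makes both sides vanish. At 0 the
      density is positive but the hypotheses on \<open>\<phi>\<close> are silent, so 0 is left to a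
      null set.\<close>
    have *: "ennreal (?e x * ?d t / 2) * (ennreal (\<phi> (x, x + t)) + ennreal (\<phi> (x + t, x))) =
        ennreal c * ennreal (?e x * x ^ i) * ennreal (?d t * t ^ j)" if "x \<noteq> 0" "t \<noteq> 0" for x t
    proof (cases "0 < x \<and> 0 < t")
      case True
      then have nn: "0 \<le> ?e x" "0 \<le> ?d t"
        using pos by (auto simp: exponential_density_def)
      have "ennreal (\<phi> (x, x + t)) + ennreal (\<phi> (x + t, x)) = ennreal (2 * c * x ^ i * t ^ j)"
        using True nonneg sum by (simp flip: ennreal_plus)
      then show ?thesis
        using True nn c by (simp flip: ennreal_mult add: ac_simps)
    next
      case False
      with that show ?thesis by (auto simp: exponential_density_def)
    qed
    have "(\<integral>\<^sup>+t. ennreal (?e x * ?d t / 2) *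
        (ennreal (\<phi> (x, x + t)) + ennreal (\<phi> (x + t, x))) \<partial>lborel) =
      (\<integral>\<^sup>+t. ennreal c * ennreal (?e x * x ^ i) * ennreal (?d t * t ^ j) \<partial>lborel)" if "x \<noteq> 0" for x
      by (rule nn_integral_cong_AE, rule eventually_mono[OF AE_lborel_singleton[of 0]], rule *[OF that])
    then show "AE x in lborel. (\<integral>\<^sup>+t. ennreal (?e x * ?d t / 2) *
        (ennreal (\<phi> (x, x + t)) + ennreal (\<phi> (x + t, x))) \<partial>lborel) =
      (\<integral>\<^sup>+t. ennreal c * ennreal (?e x * x ^ i) * ennreal (?d t * t ^ j) \<partial>lborel)"
      by (rule eventually_mono[OF AE_lborel_singleton[of 0]])
  qed
  also have "\<dots> = ennreal c * (\<integral>\<^sup>+x. ennreal (?e x * x ^ i) \<partial>lborel) *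
      (\<integral>\<^sup>+t. ennreal (?d t * t ^ j) \<partial>lborel)"
    by (simp add: nn_integral_cmult nn_integral_multc)
  also have "\<dots> = ennreal (c * (fact i / (2 * p $ 1) ^ i) * (fact j / (p $ 2) ^ j))"
  proof -
    have "(\<integral>\<^sup>+x. ennreal (?e x * x ^ i) \<partial>lborel) = ennreal (fact i / (2 * p $ 1) ^ i)"
      "(\<integral>\<^sup>+t. ennreal (?d t * t ^ j) \<partial>lborel) = ennreal (fact j / (p $ 2) ^ j)"
      using nn_integral_erlang_ith_moment[of "2 * p $ 1" 0 i]
        nn_integral_erlang_ith_moment[of "p $ 2" 0 j] pos by simp_all
    moreover have "ennreal (c * A * B) = ennreal c * ennreal A * ennreal B"
      if "0 \<le> A" "0 \<le> B" for A B
      using that c by (simp add: ennreal_mult)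
    ultimately show ?thesis
      using pos by (simp only: divide_nonneg_nonneg fact_ge_zero zero_le_power less_imp_le
          mult_nonneg_nonneg zero_le_numeral)
  qed
  finally show "(\<integral>\<^sup>+z. \<phi> z \<partial>family_measure F2_density p) =
      ennreal (c * (fact i / (2 * p $ 1) ^ i) * (fact j / (p $ 2) ^ j))" .
qed

section \<open>Total mass and moments\<close>

lemma prob_space_F2:
  assumes "p \<in> F2_domain"
  shows "prob_space (family_measure F2_density p)"
proof -
  have "has_bochner_integral (family_measure F2_density p) (\<lambda>_. 1 :: real) 1"
    using has_bochner_integral_F2[OF assms, where i = 0 and j = 0 and c = 1 and \<phi> = "\<lambda>_. 1"] by simp
  then have "(\<integral>\<^sup>+z. ennreal 1 \<partial>family_measure F2_density p) = ennreal 1"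
    by (subst nn_integral_eq_integral) (simp_all add: has_bochner_integral_iff)
  then show ?thesis
    by (intro prob_spaceI) simp
qed

lemma has_bochner_integral_F2_min:
  assumes "p \<in> F2_domain"
  shows "has_bochner_integral (family_measure F2_density p) (\<lambda>z. min (fst z) (snd z)) (1 / (2 * p $ 1))"
  using has_bochner_integral_F2[OF assms, where i = 1 and j = 0 and c = 1 and
      \<phi> = "\<lambda>z. min (fst z) (snd z)"]
    by (simp add: continuous_intros power2_eq_square algebra_simps)

lemma has_bochner_integral_F2_diff:
  assumes "p \<in> F2_domain"
  shows "has_bochner_integral (family_measure F2_density p) (\<lambda>z. \<bar>fst z - snd z\<bar>) (1 / p $ 2)"
  using has_bochner_integral_F2[OF assms, where i = 0 and j = 1 and c = 1 and
      \<phi> = "\<lambda>z. \<bar>fst z - snd z\<bar>"]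
    by (simp add: continuous_intros power2_eq_square algebra_simps)

text \<open>The symmetrisation of \<open>fst\<close> is \<open>2 * x + t\<close>, not a monomial.
  Hence \<open>fst\<close> is split into the minimum and the positive part of the difference, whose
  symmetrisation \<open>t\<close> gives \<open>c = 1 / 2\<close>.\<close>

lemma has_bochner_integral_F2_fst:
  assumes "p \<in> F2_domain"
  shows "has_bochner_integral (family_measure F2_density p) fst (1 / (2 * p $ 1) + 1 / (2 * p $ 2))"
proof -
  have "has_bochner_integral (family_measure F2_density p) (\<lambda>z. max 0 (fst z - snd z)) (1 / (2 * p $ 2))"
    using has_bochner_integral_F2[OF assms, where i = 0 and j = 1 and c = "1 / 2" and
      \<phi> = "\<lambda>z. max 0 (fst z - snd z)"]
    by (simp add: continuous_intros power2_eq_square algebra_simps)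
  from has_bochner_integral_add[OF has_bochner_integral_F2_min[OF assms] this]
  show ?thesis
    by (rule has_bochner_integral_cong[THEN iffD1, rotated 3]) auto
qed

lemma has_bochner_integral_F2_snd:
  assumes "p \<in> F2_domain"
  shows "has_bochner_integral (family_measure F2_density p) snd (1 / (2 * p $ 1) + 1 / (2 * p $ 2))"
proof -
  have "has_bochner_integral (family_measure F2_density p) (\<lambda>z. max 0 (snd z - fst z)) (1 / (2 * p $ 2))"
    using has_bochner_integral_F2[OF assms, where i = 0 and j = 1 and c = "1 / 2" and
      \<phi> = "\<lambda>z. max 0 (snd z - fst z)"]
    by (simp add: continuous_intros power2_eq_square algebra_simps)
  from has_bochner_integral_add[OF has_bochner_integral_F2_min[OF assms] this]
  show ?thesis
    by (rule has_bochner_integral_cong[THEN iffD1, rotated 3]) auto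
qed

text \<open>The product of the coordinates is minimum times maximum, that is, the squared minimum
  plus the minimum times the absolute difference; each summand symmetrises to a monomial.\<close>

lemma has_bochner_integral_F2_mult:
  assumes "p \<in> F2_domain"
  shows "has_bochner_integral (family_measure F2_density p) (\<lambda>z. fst z * snd z)
    (2 / (2 * p $ 1)\<^sup>2 + 1 / (2 * p $ 1 * p $ 2))"
proof -
  have "has_bochner_integral (family_measure F2_density p) (\<lambda>z. (min (fst z) (snd z))\<^sup>2) (2 / (2 * p $ 1)\<^sup>2)"
    using has_bochner_integral_F2[OF assms, where i = 2 and j = 0 and c = 1 and
      \<phi> = "\<lambda>z. (min (fst z) (snd z))\<^sup>2"]
    by (simp add: continuous_intros power2_eq_square algebra_simps)
  moreover have "has_bochner_integral (family_measure F2_density p)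
      (\<lambda>z. min (fst z) (snd z) * \<bar>fst z - snd z\<bar>) (1 / (2 * p $ 1 * p $ 2))"
    using has_bochner_integral_F2[OF assms, where i = 1 and j = 1 and c = 1 and
      \<phi> = "\<lambda>z. min (fst z) (snd z) * \<bar>fst z - snd z\<bar>"]
    by (simp add: continuous_intros power2_eq_square algebra_simps)
  ultimately have "has_bochner_integral (family_measure F2_density p)
      (\<lambda>z. (min (fst z) (snd z))\<^sup>2 + min (fst z) (snd z) * \<bar>fst z - snd z\<bar>)
      (2 / (2 * p $ 1)\<^sup>2 + 1 / (2 * p $ 1 * p $ 2))"
    by (rule has_bochner_integral_add)
  then show ?thesis
    by (rule has_bochner_integral_cong[THEN iffD1, rotated 3])
      (auto simp: min_def power2_eq_square algebra_simps)
qed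

section \<open>Independence\<close>

lemma F2_independent_imp_eq:
  assumes p: "p \<in> F2_domain"
    and indep: "prob_space.indep_var (family_measure F2_density p) borel fst borel snd"
  shows "p $ 1 = p $ 2"
proof -
  let ?M = "family_measure F2_density p"
  interpret prob_space ?M by (rule prob_space_F2[OF p])
  note int = has_bochner_integral_F2_fst[OF p] has_bochner_integral_F2_snd[OF p]
    has_bochner_integral_F2_mult[OF p]
  have "(\<integral>z. fst z * snd z \<partial>?M) = (\<integral>z. fst z \<partial>?M) * (\<integral>z. snd z \<partial>?M)"
    by (rule indep_var_lebesgue_integral[OF indep])
      (use int in \<open>auto simp: has_bochner_integral_iff\<close>)
  then have "2 / (2 * p $ 1)\<^sup>2 + 1 / (2 * p $ 1 * p $ 2) =
      (1 / (2 * p $ 1) + 1 / (2 * p $ 2)) * (1 / (2 * p $ 1) + 1 / (2 * p $ 2))"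
    using int[THEN has_bochner_integral_integral_eq] by simp
  moreover have pos: "0 < p $ 1" "0 < p $ 2" using p by (auto simp: F2_domain_def)
  \<comment> \<open>The mixed terms \<open>1 / (2 * p $ 1 * p $ 2)\<close> of the two sides cancel
    and leave \<open>1 / (4 * (p $ 1)^2) = 1 / (4 * (p $ 2)^2)\<close>.\<close>
  ultimately have "(p $ 1)\<^sup>2 = (p $ 2)\<^sup>2"
    by (simp add: divide_simps power2_eq_square)
  with pos show ?thesis by (simp add: power2_eq_iff_nonneg less_imp_le)
qed

text \<open>For equal parameters the exponents of both branches reduce to
  \<open>- p $ 1 * (x + y)\<close>, so the two densities agree off the axes and the diagonal, which
  form a null set.\<close>

lemma F2_measure_eq_product:
  assumes p: "p \<in> F2_domain" and eq: "p $ 1 = p $ 2"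
  defines "D \<equiv> density lborel (\<lambda>x. ennreal (exponential_density (p $ 1) x))"
  shows "family_measure F2_density p = D \<Otimes>\<^sub>M D"
proof -
  have pos: "0 < p $ 1" using p by (auto simp: F2_domain_def)
  interpret D: prob_space D
    unfolding D_def by (rule prob_space_exponential_density[OF pos])
  have "D \<Otimes>\<^sub>M D = density (lborel \<Otimes>\<^sub>M lborel) (\<lambda>(x, y).
      ennreal (exponential_density (p $ 1) x) * ennreal (exponential_density (p $ 1) y))"
    unfolding D_def
    by (rule pair_measure_density)
      (auto intro: sigma_finite_lborel D.sigma_finite_measure_axioms[unfolded D_def])
  also have "\<dots> = density (lborel \<Otimes>\<^sub>M lborel) (\<lambda>z. ennreal (F2_density p z))"
  proof (rule density_cong)
    \<comment> \<open>For fixed nonzero \<open>x\<close> only \<open>y = 0\<close> and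
      \<open>y = x\<close> are excluded, so the exceptional set is null by slices.\<close>
    have AE0: "AE x in lborel. AE y in lborel. x \<noteq> (0::real) \<and> y \<noteq> (0::real) \<and> y \<noteq> x"
      using AE_lborel_singleton[of "0::real"]
      by eventually_elim (use AE_lborel_singleton in auto)
    have "AE z in lborel \<Otimes>\<^sub>M lborel. fst z \<noteq> (0::real) \<and> snd z \<noteq> (0::real) \<and> snd z \<noteq> fst z"
    proof (rule lborel_pair.AE_pair_measure)
      show "{z \<in> space (lborel \<Otimes>\<^sub>M lborel). fst z \<noteq> (0::real) \<and> snd z \<noteq> (0::real) \<and> snd z \<noteq> fst z}
          \<in> sets (lborel \<Otimes>\<^sub>M lborel)"
        by measurable
    qed (use AE0 in simp)
    then show "AE z in lborel \<Otimes>\<^sub>M lborel. (case z of (x, y) \<Rightarrow>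
        ennreal (exponential_density (p $ 1) x) * ennreal (exponential_density (p $ 1) y)) =
        ennreal (F2_density p z)"
    proof eventually_elim
      case (elim z)
      then show ?case
        using pos eq by (cases z) (auto simp: F2_density_def exponential_density_def
            algebra_simps simp flip: ennreal_mult exp_add)
    qed
  next
    show "(\<lambda>(x, y). ennreal (exponential_density (p $ 1) x) * ennreal (exponential_density (p $ 1) y))
        \<in> borel_measurable (lborel \<Otimes>\<^sub>M lborel)"
      by measurable
  qed (simp add: lborel_prod)
  finally show ?thesis
    by (simp add: family_measure_def lborel_prod)
qed

text \<open>Independence means that the joint law is the product of the marginal laws. The measure
  is its own joint law and already factorises, so it remains to identify its marginals with the
  factors.\<close>

lemma F2_eq_imp_independent:
  assumes p: "p \<in> F2_domain" and eq: "p $ 1 = p $ 2"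
  shows "prob_space.indep_var (family_measure F2_density p) borel fst borel snd"
proof -
  let ?D = "density lborel (\<lambda>x. ennreal (exponential_density (p $ 1) x))"
  let ?M = "family_measure F2_density p"
  have pos: "0 < p $ 1" using p by (auto simp: F2_domain_def)
  interpret D: prob_space ?D
    by (rule prob_space_exponential_density[OF pos])
  interpret DD: pair_prob_space ?D ?D ..
  interpret prob_space ?M by (rule prob_space_F2[OF p])
  note M = F2_measure_eq_product[OF p eq]
  have "distr ?M borel fst = distr (?D \<Otimes>\<^sub>M ?D) ?D fst"
    unfolding M by (rule distr_cong) auto
  also have "\<dots> = ?D"
    by (rule D.distr_pair_fst)
  finally have 1: "distr ?M borel fst = ?D" .
  have "distr ?M borel snd = distr (?D \<Otimes>\<^sub>M ?D) ?D snd"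
    unfolding M by (rule distr_cong) auto
  \<comment> \<open>Swapping the two equal factors reduces the second marginal to the first.\<close>
  also have "\<dots> = ?D"
    by (subst DD.distr_pair_swap, subst distr_distr)
      (auto simp: comp_def case_prod_beta D.distr_pair_fst)
  finally have 2: "distr ?M borel snd = ?D" .
  \<comment> \<open>The pair of the two projections is the identity, so the joint law is
    \<open>?M\<close> again.\<close>
  have "distr ?M (borel \<Otimes>\<^sub>M borel) (\<lambda>z. (fst z, snd z)) = distr ?M ?M (\<lambda>z. z)"
    by (rule distr_cong) (simp_all only: borel_prod sets_family_measure prod.collapse)
  then have "distr ?M borel fst \<Otimes>\<^sub>M distr ?M borel snd =
      distr ?M (borel \<Otimes>\<^sub>M borel) (\<lambda>z. (fst z, snd z))"
    unfolding 1 2 by (simp add: M distr_id[unfolded id_def])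
  moreover have "fst \<in> borel_measurable ?M" "snd \<in> borel_measurable ?M"
    by (simp_all flip: borel_prod add: measurable_cong_sets[OF sets_family_measure refl])
  ultimately show ?thesis
    unfolding indep_var_distribution_eq by simp
qed

lemma F2_independent_eq: "F2_independent = {p \<in> F2_domain. p $ 1 = p $ 2}"
  using F2_independent_imp_eq F2_eq_imp_independent unfolding F2_independent_def by blast

section \<open>Fisher metric and exponential connection\<close>

lemma F2_domain_pos: "p \<in> F2_domain \<Longrightarrow> 0 < p $ i"
  using exhaust_2[of i] by (auto simp: F2_domain_def)

lemma open_F2_domain: "open F2_domain"
  unfolding F2_domain_def
  by (intro open_Collect_conj open_Collect_less continuous_intros)

lemma partial_cong_open:
  assumes "open S" "p \<in> S" "\<And>q. q \<in> S \<Longrightarrow> F q = G q"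
  shows "partial i F p = partial i G p"
  using frechet_derivative_cong_open[OF assms] by (simp add: partial_def deriv_along_def)

text \<open>The form with \<open>c\<close> and \<open>s\<close> serves two functions: the
  log-likelihood, with the support indicator and the statistics, and the potential, with
  \<open>- 1\<close> and 0.\<close>

lemma partial_log_linear:
  fixes p :: "real ^ 'n::finite"
  assumes "\<And>i. 0 < p $ i"
  shows "partial j (\<lambda>q. c * (\<Sum>i\<in>UNIV. ln (q $ i) - s i * q $ i)) p = c * (1 / p $ j - s j)"
proof -
  have "((\<lambda>q. c * (\<Sum>i\<in>UNIV. ln (q $ i) - s i * q $ i)) has_derivative
      (\<lambda>v. c * (\<Sum>i\<in>UNIV. v $ i * (1 / p $ i) - s i * v $ i))) (at p)"
    using assms
    by (auto intro!: derivative_eq_intros bounded_linear.has_derivative[OF bounded_linear_vec_nth]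
        sum.cong simp: less_imp_neq[THEN not_sym] divide_inverse fun_eq_iff)
  from partialI[OF this, of j] show ?thesis
    by (simp add: axis_def if_distrib[of "\<lambda>x. x / _"] if_distrib[of "\<lambda>x. _ * x"] sum_subtractf cong: if_cong)
qed

lemma partial_reciprocal:
  fixes p :: "real ^ 'n::finite"
  assumes "0 < p $ j"
  shows "partial i (\<lambda>q. c * (1 / q $ j - s)) p = c * (if i = j then - 1 / (p $ j)\<^sup>2 else 0)"
proof -
  have "((\<lambda>q. c * (1 / q $ j - s)) has_derivative (\<lambda>v. c * (- v $ j / (p $ j)\<^sup>2))) (at p)"
    using assms
    by (auto intro!: derivative_eq_intros bounded_linear.has_derivative[OF bounded_linear_vec_nth]
        simp: power2_eq_square)
  from partialI[OF this, of i] show ?thesis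
    by (auto simp: axis_def)
qed

text \<open>The sufficient statistics paired with the coordinates; the factor 2 gives the first one
  mean \<open>1 / p $ 1\<close>, parallel to \<open>1 / p $ 2\<close> for the second.\<close>

definition F2_statistic :: "2 \<Rightarrow> real \<times> real \<Rightarrow> real" where
  "F2_statistic i z = (if i = 1 then 2 * min (fst z) (snd z) else \<bar>fst z - snd z\<bar>)"

definition F2_support :: "(real \<times> real) set" where
  "F2_support = {z. 0 < fst z \<and> 0 < snd z \<and> fst z \<noteq> snd z}"

lemma F2_support_measurable [measurable]: "F2_support \<in> sets borel"
  unfolding F2_support_def
  by (intro borel_open open_Collect_conj open_Collect_less open_Collect_neq continuous_intros)

lemma F2_statistic_measurable [measurable]: "F2_statistic i \<in> borel_measurable borel"
  unfolding F2_statistic_def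
  by (intro borel_measurable_continuous_onI, cases "i = 1") (auto intro!: continuous_intros)

text \<open>In this form the indicator can be replaced by 1 in the derivatives of the log-likelihood
  under an expectation.\<close>

lemma AE_F2_support: "AE z in family_measure F2_density p. indicator F2_support z = (1::real)"
  using AE_F2 by eventually_elim (simp add: F2_support_def)

text \<open>Off the support the density vanishes for every parameter, so \<open>ln 0 = 0\<close> makes the
  log-likelihood constant there.\<close>

lemma loglik_F2:
  assumes "q \<in> F2_domain"
  shows "loglik F2_density z q =
    indicator F2_support z * (\<Sum>i\<in>UNIV. ln (q $ i) - F2_statistic i z * q $ i)"
proof (cases "z \<in> F2_support")
  case True
  then show ?thesis
    using assms by (cases z)
      (auto simp: loglik_def F2_density_def F2_support_def F2_statistic_def F2_domain_def
        sum_2 ln_mult algebra_simps)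
next
  case False
  then have "F2_density q z = 0"
    by (cases z) (auto simp: F2_density_def F2_support_def)
  with False show ?thesis by (simp add: loglik_def)
qed

text \<open>The formula \<open>loglik_F2\<close> holds on the whole open parameter domain, so it may
  be differentiated there for each fixed sample.\<close>

lemma partial_loglik_F2:
  assumes "p \<in> F2_domain"
  shows "partial j (loglik F2_density z) p = indicator F2_support z * (1 / p $ j - F2_statistic j z)"
  by (subst partial_cong_open[OF open_F2_domain assms loglik_F2],
      assumption, rule partial_log_linear, rule F2_domain_pos[OF assms])

lemma partial_partial_loglik_F2:
  assumes "p \<in> F2_domain"
  shows "partial i (partial j (loglik F2_density z)) p =
    indicator F2_support z * (if i = j then - 1 / (p $ j)\<^sup>2 else 0)"
  by (subst partial_cong_open[OF open_F2_domain assms partial_loglik_F2],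
      assumption, rule partial_reciprocal, rule F2_domain_pos[OF assms])

lemma F2_score_mean:
  assumes "p \<in> F2_domain"
  shows "has_bochner_integral (family_measure F2_density p) (\<lambda>z. 1 / p $ k - F2_statistic k z) 0"
proof -
  interpret prob_space "family_measure F2_density p" by (rule prob_space_F2[OF assms])
  have "has_bochner_integral (family_measure F2_density p) (F2_statistic k) (1 / p $ k)"
  proof (cases "k = 1")
    case True
    then have "F2_statistic k = (\<lambda>z. 2 * min (fst z) (snd z))"
      by (simp add: F2_statistic_def fun_eq_iff)
    with has_bochner_integral_mult_right[OF has_bochner_integral_F2_min[OF assms], of 2] True
    show ?thesis by simp
  next
    case False
    then have "F2_statistic k = (\<lambda>z. \<bar>fst z - snd z\<bar>)" "k = 2"
      using exhaust_2[of k] by (simp_all add: F2_statistic_def fun_eq_iff)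
    with has_bochner_integral_F2_diff[OF assms] show ?thesis by simp
  qed
  moreover have "has_bochner_integral (family_measure F2_density p) (\<lambda>_. 1 / p $ k) (1 / p $ k)"
    using prob_space by (simp add: has_bochner_integral_iff)
  ultimately show ?thesis
    using has_bochner_integral_diff by fastforce
qed

lemma fisher_coeff_F2:
  assumes "p \<in> F2_domain"
  shows "fisher_coeff F2_density i j p = (if i = j then 1 / (p $ j)\<^sup>2 else 0)"
proof -
  interpret prob_space "family_measure F2_density p" by (rule prob_space_F2[OF assms])
  have "expect F2_density p (\<lambda>z. partial i (partial j (loglik F2_density z)) p) =
      expect F2_density p (\<lambda>z. if i = j then - 1 / (p $ j)\<^sup>2 else 0)"
    unfolding expect_def partial_partial_loglik_F2[OF assms]
    by (intro integral_cong_AE eventually_mono[OF AE_F2_support]) auto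
  then show ?thesis
    using prob_space by (simp add: fisher_coeff_def expect_def)
qed

text \<open>At \<open>\<alpha> = 1\<close> the cubic term has coefficient 0; almost everywhere the
  rest is a constant times the score, which has mean zero.\<close>

lemma alpha_coeff_F2:
  assumes "p \<in> F2_domain"
  shows "alpha_coeff F2_density 1 i j k p = 0"
proof -
  have "alpha_coeff F2_density 1 i j k p =
      expect F2_density p (\<lambda>z. (if i = j then - 1 / (p $ j)\<^sup>2 else 0) * (1 / p $ k - F2_statistic k z))"
    unfolding alpha_coeff_def expect_def partial_partial_loglik_F2[OF assms] partial_loglik_F2[OF assms]
    by (intro integral_cong_AE eventually_mono[OF AE_F2_support]) auto
  also have "\<dots> = 0"
    unfolding expect_def using F2_score_mean[OF assms, of k, THEN has_bochner_integral_integral_eq]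
    by simp
  finally show ?thesis .
qed

lemma fisher_metric_F2:
  assumes "p \<in> F2_domain"
  shows "fisher_metric F2_density p u v = (\<Sum>i\<in>UNIV. u $ i * v $ i / (p $ i)\<^sup>2)"
  by (simp add: fisher_metric_def fisher_coeff_F2[OF assms] if_distrib[of "\<lambda>x. x * _"] cong: if_cong)

lemma fisher_metric_F2_coord_field:
  assumes "p \<in> F2_domain"
  shows "fisher_metric F2_density p u (coord_field j q) = u $ j / (p $ j)\<^sup>2"
  by (simp add: fisher_metric_F2[OF assms] coord_field_def axis_def if_distrib[of "\<lambda>x. _ * x"]
      if_distrib[of "\<lambda>x. x / _"] cong: if_cong)

text \<open>The metric is diagonal with nonzero entries, so pairing with the \<open>k\<close>-th
  coordinate field reads off the \<open>k\<close>-th component up to the factor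
  \<open>1 / (p $ k)^2\<close>.\<close>

lemma F2_alpha_connection_flat:
  assumes "is_alpha_connection F2_domain F2_density 1 nab" "p \<in> F2_domain"
  shows "nab (coord_field i) (coord_field j) p = 0"
proof -
  have "nab (coord_field i) (coord_field j) p $ k / (p $ k)\<^sup>2 = 0" for k
    using assms alpha_coeff_F2 by (auto simp: is_alpha_connection_def fisher_metric_F2_coord_field)
  then show ?thesis
    using F2_domain_pos[OF assms(2)] by (auto simp: vec_eq_iff less_le)
qed

lemma F2_alpha_connection_eq_deriv_along:
  assumes "is_alpha_connection F2_domain F2_density 1 nab"
    and "smooth_on F2_domain X" "smooth_on F2_domain Y" "p \<in> F2_domain"
  shows "nab X Y p = deriv_along X Y p"
  by (rule flat_connection_eq_deriv_along[OF open_F2_domain])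
    (use assms F2_alpha_connection_flat in \<open>auto simp: is_alpha_connection_def\<close>)

text \<open>The existence half: it keeps the statements about every such connection from being
  vacuous.\<close>

lemma is_alpha_connection_F2_deriv_along: "is_alpha_connection F2_domain F2_density 1 deriv_along"
proof -
  have "deriv_along (coord_field i) (coord_field j) p = 0" for i j :: 2 and p
    unfolding coord_field_def by (simp add: deriv_along_def)
  then show ?thesis
    by (simp add: is_alpha_connection_def affine_connection_on_deriv_along[OF open_F2_domain]
        torsion_free_on_deriv_along alpha_coeff_F2 fisher_metric_F2)
qed

section \<open>The graph immersion\<close>

text \<open>Written with \<open>- 1\<close> and \<open>0 * q $ i\<close> to be an instance of
  \<open>partial_log_linear\<close>.\<close>

lemma F2_potential_eq:
  assumes "q \<in> F2_domain"
  shows "F2_potential q = - 1 * (\<Sum>i\<in>UNIV. ln (q $ i) - 0 * q $ i)"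
  using assms by (simp add: F2_potential_def sum_2 F2_domain_def ln_mult)

lemma partial_F2_potential: "p \<in> F2_domain \<Longrightarrow> partial j F2_potential p = - 1 * (1 / p $ j - 0)"
  by (subst partial_cong_open[OF open_F2_domain _ F2_potential_eq],
      assumption, assumption, rule partial_log_linear, rule F2_domain_pos)

lemma partial_partial_F2_potential:
  "p \<in> F2_domain \<Longrightarrow> partial i (partial j F2_potential) p = (if i = j then 1 / (p $ j)\<^sup>2 else 0)"
  by (subst partial_cong_open[OF open_F2_domain _ partial_F2_potential],
      assumption, assumption, subst partial_reciprocal) (simp_all add: F2_domain_pos)

lemma smooth_on_F2_potential: "smooth_on F2_domain F2_potential"
  unfolding smooth_on_def
proof
  fix k
  note op = open_F2_domain
  have "Ck_on k F2_domain (\<lambda>q. - 1 *\<^sub>R (\<Sum>i\<in>UNIV. ln (q $ i)))"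
    by (intro Ck_on_scaleR Ck_on_const Ck_on_sum Ck_on_ln op Ck_on_linear[OF bounded_linear_vec_nth])
      (auto simp: F2_domain_pos)
  then show "Ck_on k F2_domain F2_potential"
    by (rule Ck_on_cong[OF op, rotated]) (simp add: F2_potential_eq)
qed

lemma is_potential_function_F2:
  assumes "is_alpha_connection F2_domain F2_density 1 nab"
  shows "is_potential_function F2_domain (fisher_metric F2_density) nab F2_potential"
  unfolding is_potential_function_def
  by (auto simp: smooth_on_F2_potential F2_alpha_connection_flat[OF assms] partial_partial_F2_potential
      fisher_metric_F2_coord_field) (auto simp: coord_field_def axis_def)

text \<open>As a combination of constant axis vectors, a vector given by its entries falls under the
  rules for sums and scalar multiples, both for derivatives and for smoothness.\<close>

lemma vector_3_eq: "(vector [a, b, c] :: real ^ 3) = a *\<^sub>R axis 1 1 + b *\<^sub>R axis 2 1 + c *\<^sub>R axis 3 1"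
  by (simp add: vec_eq_iff forall_3 axis_def)

lemma has_derivative_vector_3:
  assumes "(a has_derivative a') F" "(b has_derivative b') F" "(c has_derivative c') F"
  shows "((\<lambda>x. vector [a x, b x, c x] :: real ^ 3) has_derivative (\<lambda>v. vector [a' v, b' v, c' v])) F"
  unfolding vector_3_eq using assms
  by (auto intro!: has_derivative_add bounded_linear.has_derivative[OF bounded_linear_scaleR_left])

section \<open>Differential and structure equation of the graph\<close>

lemma has_derivative_F2_potential:
  assumes p: "p \<in> F2_domain"
  shows "(F2_potential has_derivative (\<lambda>v. - (v $ 1 / p $ 1 + v $ 2 / p $ 2))) (at p)"
proof -
  have "0 < p $ 1" "0 < p $ 2" using F2_domain_pos[OF p] by auto
  then show ?thesis
    unfolding F2_potential_def
    by (auto intro!: derivative_eq_intros bounded_linear.has_derivative[OF bounded_linear_vec_nth]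
        simp: divide_simps)
qed

lemma has_derivative_F2_immersion:
  assumes "p \<in> F2_domain"
  shows "(F2_immersion has_derivative (\<lambda>v. vector [v $ 1, v $ 2, - (v $ 1 / p $ 1 + v $ 2 / p $ 2)])) (at p)"
  unfolding F2_immersion_def
  by (intro has_derivative_vector_3 has_derivative_F2_potential[OF assms]
      bounded_linear_imp_has_derivative bounded_linear_vec_nth)

lemma smooth_on_F2_immersion: "smooth_on F2_domain F2_immersion"
  unfolding smooth_on_def F2_immersion_def vector_3_eq
  using smooth_on_F2_potential unfolding smooth_on_def
  by (intro allI Ck_on_add Ck_on_scaleR Ck_on_const open_F2_domain
      Ck_on_linear[OF bounded_linear_vec_nth]) auto

lemma deriv_along_F2_immersion:
  "p \<in> F2_domain \<Longrightarrow> deriv_along Y F2_immersion p =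
    vector [Y p $ 1, Y p $ 2, - (Y p $ 1 / p $ 1 + Y p $ 2 / p $ 2)]"
  by (rule deriv_alongI[OF has_derivative_F2_immersion])

text \<open>The first two entries of the equation hold because the connection is the flat
  derivative. In the third, differentiating \<open>- (Y q $ 1 / q $ 1 + Y q $ 2 / q $ 2)\<close>
  gives the entry of the push-forward from the components of \<open>Y\<close>, and exactly the
  metric from the reciprocals \<open>1 / q $ i\<close>.\<close>

lemma realizes_F2:
  assumes "is_alpha_connection F2_domain F2_density 1 nab"
  shows "realizes_as_affine_immersion F2_domain (fisher_metric F2_density) nab
    F2_immersion F2_transversal"
  unfolding realizes_as_affine_immersion_def
proof (intro conjI ballI allI impI)
  show "smooth_on F2_domain F2_immersion" by (rule smooth_on_F2_immersion)
  show "smooth_on F2_domain F2_transversal" unfolding F2_transversal_def by (rule smooth_on_const)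
next
  fix p assume p: "p \<in> F2_domain"
  note D = frechet_derivative_at[OF has_derivative_F2_immersion[OF p], symmetric]
  \<comment> \<open>The first two entries of the differential are \<open>v\<close> itself. This
    gives injectivity, and a preimage of \<open>(0, 0, 1)\<close> would be 0, whose image has third
    entry 0.\<close>
  show "inj (frechet_derivative F2_immersion (at p))"
    unfolding D inj_def by (auto simp: vec_eq_iff forall_3 forall_2)
  show "F2_transversal p \<notin> range (frechet_derivative F2_immersion (at p))"
    unfolding D F2_transversal_def by (auto simp: vec_eq_iff forall_3)
next
  fix X Y :: "real ^ 2 \<Rightarrow> real ^ 2" and p
  assume X: "smooth_on F2_domain X" and Y: "smooth_on F2_domain Y" and p: "p \<in> F2_domain"
  let ?D = "frechet_derivative Y (at p)"
  have pos: "0 < p $ 1" "0 < p $ 2" using F2_domain_pos[OF p] by auto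
  have Yd: "((\<lambda>q. Y q $ i) has_derivative (\<lambda>v. ?D v $ i)) (at p)" for i
    using smooth_on_differentiable[OF Y p]
    by (intro bounded_linear.has_derivative[OF bounded_linear_vec_nth]) (simp add: frechet_derivative_works)
  have "((\<lambda>q. - (Y q $ 1 / q $ 1 + Y q $ 2 / q $ 2)) has_derivative
      (\<lambda>v. - (?D v $ 1 / p $ 1 + ?D v $ 2 / p $ 2) +
        (Y p $ 1 * v $ 1 / (p $ 1)\<^sup>2 + Y p $ 2 * v $ 2 / (p $ 2)\<^sup>2))) (at p)"
    using pos
    by (auto intro!: derivative_eq_intros Yd bounded_linear.has_derivative[OF bounded_linear_vec_nth]
        simp: fun_eq_iff power2_eq_square field_simps)
  from deriv_alongI[OF has_derivative_vector_3[OF Yd Yd this], of X 1 2]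
  have "deriv_along X (\<lambda>q. vector [Y q $ 1, Y q $ 2, - (Y q $ 1 / q $ 1 + Y q $ 2 / q $ 2)]) p =
      deriv_along (deriv_along X Y) F2_immersion p + fisher_metric F2_density p (X p) (Y p) *\<^sub>R F2_transversal p"
    by (simp add: deriv_along_F2_immersion[OF p] F2_transversal_def fisher_metric_F2[OF p] sum_2
        vec_eq_iff forall_3 deriv_along_def[of X Y] mult.commute)
  \<comment> \<open>Here the exponential connection enters: on smooth fields it is the flat
    derivative.\<close>
  moreover have "deriv_along (nab X Y) F2_immersion p = deriv_along (deriv_along X Y) F2_immersion p"
    using F2_alpha_connection_eq_deriv_along[OF assms X Y p] by (simp add: deriv_along_def)
  \<comment> \<open>The closed form of the push-forward holds on an open set, so it may be
    differentiated once more.\<close>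
  moreover have "deriv_along X (deriv_along Y F2_immersion) p =
      deriv_along X (\<lambda>q. vector [Y q $ 1, Y q $ 2, - (Y q $ 1 / q $ 1 + Y q $ 2 / q $ 2)] :: real ^ 3) p"
    unfolding deriv_along_def[of X]
    using frechet_derivative_cong_open[OF open_F2_domain p deriv_along_F2_immersion] by simp
  ultimately show "deriv_along X (deriv_along Y F2_immersion) p =
      deriv_along (nab X Y) F2_immersion p + fisher_metric F2_density p (X p) (Y p) *\<^sub>R F2_transversal p"
    by simp
qed

section \<open>The submanifold of independence\<close>

text \<open>A single defining function works near every point: the difference of the coordinates, on
  the whole domain.\<close>

lemma is_curve_submanifold_F2: "is_curve_submanifold F2_domain F2_independent"
  unfolding is_curve_submanifold_def
proof (intro conjI ballI exI)
  show "F2_independent \<subseteq> F2_domain" by (auto simp: F2_independent_def)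
  fix p assume p: "p \<in> F2_independent"
  let ?\<phi> = "\<lambda>q :: real ^ 2. q $ 1 - q $ 2"
  have lin: "bounded_linear ?\<phi>"
    by (intro bounded_linear_sub bounded_linear_vec_nth)
  show "open F2_domain" by (rule open_F2_domain)
  show "p \<in> F2_domain" using p by (auto simp: F2_independent_def)
  show "F2_domain \<subseteq> F2_domain" ..
  show "smooth_on F2_domain ?\<phi>" unfolding smooth_on_def using Ck_on_linear[OF lin] by blast
  show "surj (frechet_derivative ?\<phi> (at q))" for q
  proof -
    have "frechet_derivative ?\<phi> (at q) = ?\<phi>"
      by (rule frechet_derivative_at[OF bounded_linear_imp_has_derivative[OF lin], symmetric])
    moreover have "surj ?\<phi>"
      \<comment> \<open>The vector \<open>[t, 0]\<close> has coordinate difference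
        \<open>t\<close>.\<close>
      by (rule surjI[of _ "\<lambda>t. vector [t, 0]"]) simp
    ultimately show ?thesis by simp
  qed
  show "F2_independent \<inter> F2_domain = {q \<in> F2_domain. ?\<phi> q = 0}"
    by (auto simp: F2_independent_eq)
qed

lemma F2_immersion_diagonal: "F2_immersion (vector [a, a]) = vector [a, a, - ln (a ^ 2)]"
  by (simp add: F2_immersion_def F2_potential_def power2_eq_square)

text \<open>This parametrisation turns the image of the submanifold under the immersion into the
  explicit curve.\<close>

lemma F2_independent_diagonal: "F2_independent = (\<lambda>a. vector [a, a]) ` {0<..}"
proof (intro equalityI subsetI)
  fix p assume "p \<in> F2_independent"
  then have "0 < p $ 1" "p = vector [p $ 1, p $ 1]"
    by (auto simp: F2_independent_eq F2_domain_def vec_eq_iff forall_2)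
  then show "p \<in> (\<lambda>a. vector [a, a]) ` {0<..}" by blast
qed (auto simp: F2_independent_eq F2_domain_def)

theorem proposition2p5:
  shows "(\<exists>nab. is_alpha_connection F2_domain F2_density 1 nab) \<and>
    (\<forall>nab. is_alpha_connection F2_domain F2_density 1 nab \<longrightarrow>
       is_potential_function F2_domain (fisher_metric F2_density) nab F2_potential \<and>
       realizes_as_affine_immersion F2_domain (fisher_metric F2_density) nab
         F2_immersion F2_transversal) \<and>
    is_curve_submanifold F2_domain F2_independent \<and>
    F2_independent = {p \<in> F2_domain. p $ 1 = p $ 2} \<and>
    F2_immersion ` F2_independent =
      (\<lambda>a::real. vector [a, a, - ln (a ^ 2)] :: real ^ 3) ` {0<..} \<and>
    (\<forall>a>0. F2_immersion (vector [a, a]) = vector [a, a, - ln (a ^ 2)] \<and>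
       F2_transversal (vector [a, a]) = vector [0, 0, 1])"
proof (intro conjI allI impI)
  show "\<exists>nab. is_alpha_connection F2_domain F2_density 1 nab"
    using is_alpha_connection_F2_deriv_along by blast
  show "F2_immersion ` F2_independent = (\<lambda>a::real. vector [a, a, - ln (a ^ 2)] :: real ^ 3) ` {0<..}"
    unfolding F2_independent_diagonal image_image F2_immersion_diagonal ..
qed (rule is_potential_function_F2 realizes_F2 is_curve_submanifold_F2 F2_independent_eq
    F2_immersion_diagonal F2_transversal_def; assumption?)+

end
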